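(* Let $F$ be a field, let $A$ be an $F$-algebra, let $M$ be an $A$-bimodule, and let $\Theta\subseteq M$ be the linear span of the set $\{am \mid a\in A,\ m\in M,\ ama=0\}$. If $A$ is two-sided zero product determined, then every derivation $\delta:A\to M$ satisfies $\delta(A)\subseteq\Theta$.
   Context: $F$ is an arbitrary field; an algebra means an associative $F$-algebra with unity $1$; all bimodules are unital. An algebra $A$ is two-sided zero product determined (2-zpd) if every bilinear functional $\varphi:A\times A\to F$ with the property that for all $x,y\in A$, $xy=yx=0$ implies $\varphi(x,y)=0$, is of the form $\varphi(x,y)=\tau_1(xy)+\tau_2(yx)$ (for all $x,y\in A$) for some linear functionals $\tau_1,\tau_2$ on $A$. A derivation $\delta:A\to M$ is an $F$-linear map with $\delta(xy)=\delta(x)y+x\delta(y)$ for all $x,y\in A$. *)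

theory Defs
  imports Complex_Main
begin

text \<open>
  The sort \<open>{ring, monoid_mult}\<close> is \<open>ring_1\<close> without \<open>0 \<noteq> 1\<close>: the zero algebra is not excluded.
\<close>

locale unital_algebra = vector_space scaleA
  for scaleA :: "'f::field \<Rightarrow> 'a::{ring, monoid_mult} \<Rightarrow> 'a" +
  assumes scale_mult_left: "scaleA c x * y = scaleA c (x * y)"
    and scale_mult_right: "x * scaleA c y = scaleA c (x * y)"

text \<open>
  Linearity of both actions in both arguments says in particular that the scalars act centrally,
  i.e. \<open>scaleM c m = lact (scaleA c 1) m = ract m (scaleA c 1)\<close>.
\<close>

locale unital_bimodule =
  A: unital_algebra scaleA + M: vector_space scaleM
  for scaleA :: "'f::field \<Rightarrow> 'a::{ring, monoid_mult} \<Rightarrow> 'a"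
    and scaleM :: "'f \<Rightarrow> 'm::ab_group_add \<Rightarrow> 'm" +
  fixes lact :: "'a \<Rightarrow> 'm \<Rightarrow> 'm"
    and ract :: "'m \<Rightarrow> 'a \<Rightarrow> 'm"
  assumes lact_linear_left: "Vector_Spaces.linear scaleA scaleM (\<lambda>a. lact a m)"
    and lact_linear_right: "Vector_Spaces.linear scaleM scaleM (\<lambda>m. lact a m)"
    and ract_linear_left: "Vector_Spaces.linear scaleM scaleM (\<lambda>m. ract m a)"
    and ract_linear_right: "Vector_Spaces.linear scaleA scaleM (\<lambda>a. ract m a)"
    and lact_mult: "lact (a * b) m = lact a (lact b m)"
    and ract_mult: "ract m (a * b) = ract (ract m a) b"
    and lact_ract: "ract (lact a m) b = lact a (ract m b)"
    and lact_one: "lact 1 m = m"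
    and ract_one: "ract m 1 = m"

definition linear_functional ::
    "('f::field \<Rightarrow> 'a::ab_group_add \<Rightarrow> 'a) \<Rightarrow> ('a \<Rightarrow> 'f) \<Rightarrow> bool" where
  "linear_functional scaleA \<tau> \<longleftrightarrow> Vector_Spaces.linear scaleA (*) \<tau>"

definition bilinear_functional ::
    "('f::field \<Rightarrow> 'a::ab_group_add \<Rightarrow> 'a) \<Rightarrow> ('a \<Rightarrow> 'a \<Rightarrow> 'f) \<Rightarrow> bool" where
  "bilinear_functional scaleA \<phi> \<longleftrightarrow>
     (\<forall>x. linear_functional scaleA (\<lambda>y. \<phi> x y)) \<and>
     (\<forall>y. linear_functional scaleA (\<lambda>x. \<phi> x y))"

definition two_sided_zpd ::
    "('f::field \<Rightarrow> 'a::{ring, monoid_mult} \<Rightarrow> 'a) \<Rightarrow> bool" where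
  "two_sided_zpd scaleA \<longleftrightarrow>
     (\<forall>\<phi>. bilinear_functional scaleA \<phi> \<longrightarrow>
        (\<forall>x y. x * y = 0 \<and> y * x = 0 \<longrightarrow> \<phi> x y = 0) \<longrightarrow>
        (\<exists>\<tau>\<^sub>1 \<tau>\<^sub>2. linear_functional scaleA \<tau>\<^sub>1 \<and> linear_functional scaleA \<tau>\<^sub>2 \<and>
           (\<forall>x y. \<phi> x y = \<tau>\<^sub>1 (x * y) + \<tau>\<^sub>2 (y * x))))"

context unital_bimodule
begin

definition derivation :: "('a \<Rightarrow> 'm) \<Rightarrow> bool" where
  "derivation \<delta> \<longleftrightarrow>
     Vector_Spaces.linear scaleA scaleM \<delta> \<and>
     (\<forall>x y. \<delta> (x * y) = ract (\<delta> x) y + lact x (\<delta> y))"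

definition Theta :: "'m set" where
  "Theta = M.span {lact a m | a m. lact a (ract m a) = 0}"

end

end

theory Submission
  imports Defs
begin

text \<open>
  Let \<open>f\<close> be a linear functional on \<open>M\<close> that vanishes on \<open>\<Theta>\<close>. If \<open>xy = yx = 0\<close>, then
  \<open>x \<delta>(y) x = x (\<delta>(yx) - y \<delta>(x)) = 0\<close>, so \<open>x \<delta>(y) \<in> \<Theta>\<close>. Hence \<open>\<phi>(x,y) = f(x \<delta>(y))\<close>
  has the form \<open>\<tau>\<^sub>1(xy) + \<tau>\<^sub>2(yx)\<close>, and \<open>f(\<delta>(z)) = \<phi>(1,z) = \<phi>(z,1) = f(z \<delta>(1)) = 0\<close>.
  Since functionals separate points from subspaces, \<open>\<delta>(z) \<in> \<Theta>\<close>.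
\<close>

text \<open>A basis \<open>B\<close> of \<open>span S\<close> stays independent when
  \<open>v\<close> is adjoined, so the values 0 on \<open>B\<close> and 1 at \<open>v\<close> extend
  to a linear functional on the whole space.\<close>

lemma (in vector_space) separating_functional:
  assumes "v \<notin> span S"
  obtains f where "Vector_Spaces.linear scale (*) f" "\<And>x. x \<in> span S \<Longrightarrow> f x = 0" "f v = 1"
proof -
  interpret F: vector_space "(*) :: 'a \<Rightarrow> 'a \<Rightarrow> 'a"
    by unfold_locales (simp_all add: algebra_simps)
  interpret P: vector_space_pair scale "(*) :: 'a \<Rightarrow> 'a \<Rightarrow> 'a" ..
  obtain B where B: "B \<subseteq> span S" "independent B" "span S \<subseteq> span B"
    by (rule maximal_independent_subset)
  have "span B \<subseteq> span S"
    using B(1) by (simp add: span_minimal)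
  \<comment> \<open>The first fact makes \<open>insert v B\<close> independent; the second ensures
    that \<open>if x = v then 1 else 0\<close> is 0 on all of \<open>B\<close>.\<close>
  then have v: "v \<notin> span B" and "v \<notin> B"
    using assms span_base by blast+
  have "independent (insert v B)"
    using v B(2) by (simp add: independent_insertI)
  then obtain f where lin: "Vector_Spaces.linear scale (*) f"
    and f: "\<forall>x\<in>insert v B. f x = (if x = v then 1 else 0)"
    using P.linear_independent_extend[of "insert v B" "\<lambda>x. if x = v then 1 else 0"] by blast
  have "f x = 0" if "x \<in> span S" for x
  proof (rule P.linear_eq_0_on_span[OF lin])
    show "f b = 0" if "b \<in> B" for b
      using f that \<open>v \<notin> B\<close> by auto
    show "x \<in> span B"
      using that B(3) by blast
  qed
  then show thesis
    using that lin f by simp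
qed

context unital_bimodule
begin

lemma derivation_one:
  assumes "derivation \<delta>"
  shows "\<delta> 1 = 0"
proof -
  \<comment> \<open>Since 1 acts as the identity on both sides, this reads \<delta>(1) = \<delta>(1)
    + \<delta>(1).\<close>
  have "\<delta> (1 * 1) = ract (\<delta> 1) 1 + lact 1 (\<delta> 1)"
    using assms unfolding derivation_def by blast
  then show ?thesis
    by (simp add: lact_one ract_one)
qed

lemma lact_derivation_in_Theta:
  assumes \<delta>: "derivation \<delta>" and xy: "x * y = 0" "y * x = 0"
  shows "lact x (\<delta> y) \<in> Theta"
proof -
  interpret \<delta>: Vector_Spaces.linear scaleA scaleM \<delta>
    using \<delta> unfolding derivation_def by blast
  interpret lr: Vector_Spaces.linear scaleM scaleM "lact x"
    by (rule lact_linear_right)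
  interpret ll: Vector_Spaces.linear scaleA scaleM "\<lambda>a. lact a (\<delta> x)"
    by (rule lact_linear_left)
  have "ract (\<delta> y) x + lact y (\<delta> x) = 0"
    using \<delta> xy \<delta>.zero unfolding derivation_def by metis
  \<comment> \<open>The Leibniz rule applied to yx = 0, with \<delta>(0) = 0 by linearity.\<close>
  then have "ract (\<delta> y) x = - lact y (\<delta> x)"
    by (simp add: eq_neg_iff_add_eq_0)
  \<comment> \<open>Associativity of the left action moves x next to y, so that xy = 0
    applies.\<close>
  then have "lact x (ract (\<delta> y) x) = - lact (x * y) (\<delta> x)"
    by (simp add: lr.neg lact_mult)
  also have "\<dots> = 0"
    using xy ll.zero by simp
  \<comment> \<open>Thus x \<delta>(y) is itself a generator of \<open>Theta\<close>, with
    \<open>a\<close> = x and \<open>m\<close> = \<delta>(y).\<close>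
  finally show ?thesis
    unfolding Theta_def by (blast intro: M.span_base)
qed

lemma bilinear_functional_lact:
  assumes f: "Vector_Spaces.linear scaleM (*) f" and \<delta>: "Vector_Spaces.linear scaleA scaleM \<delta>"
  shows "bilinear_functional scaleA (\<lambda>x y. f (lact x (\<delta> y)))"
proof -
  have "linear_functional scaleA (\<lambda>y. f (lact x (\<delta> y)))" for x
    using Vector_Spaces.linear_compose[OF Vector_Spaces.linear_compose[OF \<delta> lact_linear_right] f]
    by (simp add: linear_functional_def o_def)
  moreover have "linear_functional scaleA (\<lambda>x. f (lact x (\<delta> y)))" for y
    using Vector_Spaces.linear_compose[OF lact_linear_left f]
    by (simp add: linear_functional_def o_def)
  ultimately show ?thesis
    by (simp add: bilinear_functional_def)
qed

lemma derivation_in_Theta: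
  assumes zpd: "two_sided_zpd scaleA" and \<delta>: "derivation \<delta>"
  shows "\<delta> z \<in> Theta"
proof (rule ccontr)
  assume "\<delta> z \<notin> Theta"
  then have "\<delta> z \<notin> M.span {lact a m | a m. lact a (ract m a) = 0}"
    unfolding Theta_def .
  then obtain f where f: "Vector_Spaces.linear scaleM (*) f"
    and f0: "\<And>m. m \<in> Theta \<Longrightarrow> f m = 0" and f1: "f (\<delta> z) = 1"
    unfolding Theta_def by (rule M.separating_functional) blast
  interpret f: Vector_Spaces.linear scaleM "(*)" f
    by (rule f)
  interpret lz: Vector_Spaces.linear scaleM scaleM "lact z"
    by (rule lact_linear_right)
  have "bilinear_functional scaleA (\<lambda>x y. f (lact x (\<delta> y)))"
    using bilinear_functional_lact f \<delta> unfolding derivation_def by blast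
  moreover have "\<forall>x y. x * y = 0 \<and> y * x = 0 \<longrightarrow> f (lact x (\<delta> y)) = 0"
    using f0 lact_derivation_in_Theta \<delta> by blast
  ultimately obtain \<tau>\<^sub>1 \<tau>\<^sub>2 where \<tau>: "\<And>x y. f (lact x (\<delta> y)) = \<tau>\<^sub>1 (x * y) + \<tau>\<^sub>2 (y * x)"
    using zpd[unfolded two_sided_zpd_def, rule_format, of "\<lambda>x y. f (lact x (\<delta> y))"] by blast
  \<comment> \<open>As 1 commutes with z, the pairs (1,z) and (z,1) both give
    \<open>\<tau>\<^sub>1 z + \<tau>\<^sub>2 z\<close>.\<close>
  have "f (\<delta> z) = f (lact z (\<delta> 1))"
    using \<tau>[of 1 z] \<tau>[of z 1] by (simp add: lact_one)
  also have "\<dots> = 0"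
    by (simp add: derivation_one[OF \<delta>])
  finally show False
    using f1 by simp
qed

end

theorem theorem3p3:
  fixes scaleA :: "'f::field \<Rightarrow> 'a::{ring, monoid_mult} \<Rightarrow> 'a"
    and scaleM :: "'f \<Rightarrow> 'm::ab_group_add \<Rightarrow> 'm"
    and lact :: "'a \<Rightarrow> 'm \<Rightarrow> 'm"
    and ract :: "'m \<Rightarrow> 'a \<Rightarrow> 'm"
  assumes "unital_bimodule scaleA scaleM lact ract"
    and "two_sided_zpd scaleA"
  shows "\<forall>\<delta>. unital_bimodule.derivation scaleA scaleM lact ract \<delta> \<longrightarrow>
           range \<delta> \<subseteq> unital_bimodule.Theta scaleM lact ract"
  using unital_bimodule.derivation_in_Theta[OF assms] by blast

end
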